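(* Let $n\ge2$ and let $0\le\alpha_1<\dots<\alpha_n$ be integers. If there exists a correct score sequence for $D=\{\alpha_1,\dots,\alpha_n\}$, i.e. positive integers $x_1,\dots,x_n$ such that the non-decreasing sequence consisting of $\alpha_i$ repeated $x_i$ times ($i=1,\dots,n$) is the score sequence of some tournament, then the reconstruction variant of the net-building algorithm (described in the context), run on $D$, finds at least one correct score sequence: some cell of $L_n$ is nonempty, and starting from it and repeatedly following a stored triple $(p',q',x)$ in $L_\ell(p,q)$ to the cell $L_{\ell-1}(p',q')$ while recording $x_\ell=x$, for $\ell=n,n-1,\dots,1$, yields a correct score sequence $(x_1,\dots,x_n)$ for $D$.
   Context: A tournament is an orientation of a complete graph; its score sequence is its sequence of out-degrees. Reconstruction variant of the net-building algorithm: set $\alpha_0=0$. For $k=0,\dots,n$ there is a table $L_k$ with cells indexed by integer pairs $(p,q)$, $0\le p\le 2\alpha_k+1$, $0\le q\le(2\alpha_k+1)\alpha_k$; each cell is a set of triples $(p',q',x)$, initially empty except $L_0(0,0)=\{(0,0,0)\}$. Let $B(p',q',a)=\frac{h+\sqrt{h^2+8(q'-p'(p'-1)/2)}}{2}$ with $h=2(a-p')+1$. First part: for $\ell=1,\dots,n-1$, for each integer $x$ with $1\le x\le 2\alpha_\ell+1$, for each $(p',q')$ with $0\le p'\le 2\alpha_{\ell-1}+1$, $0\le q'\le(2\alpha_{\ell-1}+1)\alpha_{\ell-1}$ and $L_{\ell-1}(p',q')\ne\emptyset$: if $x\le B(p',q',\alpha_\ell)$ and $L_\ell(p'+x,q'+x\alpha_\ell)$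 is currently empty, insert $(p',q',x)$ into it. Second part: for each $(p',q')$ in the index range of $L_{n-1}$ with $L_{n-1}(p',q')\ne\emptyset$, let $t=B(p',q',\alpha_n)$; if $t$ is an integer with $t\ge1$ and $L_n(p'+t,q'+t\alpha_n)$ is currently empty, insert $(p',q',t)$ into it. *)

theory Defs
  imports Complex_Main
begin

definition tournament :: "'a set \<Rightarrow> 'a rel \<Rightarrow> bool" where
  "tournament V R \<longleftrightarrow> finite V \<and> R \<subseteq> V \<times> V \<and> asym R \<and> total_on V R"

definition out_degree :: "'a rel \<Rightarrow> 'a \<Rightarrow> nat" where
  "out_degree R v = card {w. (v, w) \<in> R}"

definition enumerates :: "'a list \<Rightarrow> 'a set \<Rightarrow> bool" where
  "enumerates xs A \<longleftrightarrow> distinct xs \<and> set xs = A"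

definition is_score_sequence :: "nat list \<Rightarrow> bool" where
  "is_score_sequence s \<longleftrightarrow>
     (\<exists>(V :: nat set) R vs. tournament V R \<and> enumerates vs V \<and> s = map (out_degree R) vs)"

text \<open>Both \<open>\<alpha>\<close> and \<open>x\<close> are indexed by \<open>{1..n}\<close>; other arguments are irrelevant.\<close>

definition correct_score_sequence :: "nat \<Rightarrow> (nat \<Rightarrow> nat) \<Rightarrow> (nat \<Rightarrow> nat) \<Rightarrow> bool" where
  "correct_score_sequence n \<alpha> x \<longleftrightarrow>
     (\<forall>i\<in>{1..n}. x i \<ge> 1) \<and>
     is_score_sequence (concat (map (\<lambda>i. replicate (x i) (\<alpha> i)) [1..<n+1]))"

type_synonym cell = "nat \<times> nat"
type_synonym tables = "nat \<Rightarrow> cell \<Rightarrow> (nat \<times> nat \<times> nat) set"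

definition cells :: "nat \<Rightarrow> cell set" where
  "cells a = {0..2*a+1} \<times> {0..(2*a+1)*a}"

definition init_tables :: tables where
  "init_tables k c = (if k = 0 \<and> c = (0, 0) then {(0, 0, 0)} else {})"

definition bound :: "nat \<Rightarrow> nat \<Rightarrow> nat \<Rightarrow> real" where
  "bound p q a =
     (let h = 2 * (real a - real p) + 1
      in (h + sqrt (h\<^sup>2 + 8 * (real q - real p * (real p - 1) / 2))) / 2)"

definition insert_if_empty :: "nat \<Rightarrow> cell \<Rightarrow> nat \<times> nat \<times> nat \<Rightarrow> tables \<Rightarrow> tables" where
  "insert_if_empty k c t L = (if L k c = {} then L(k := (L k)(c := {t})) else L)"

definition step1 :: "(nat \<Rightarrow> nat) \<Rightarrow> nat \<Rightarrow> nat \<Rightarrow> cell \<Rightarrow> tables \<Rightarrow> tables" where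
  "step1 \<alpha> l x = (\<lambda>(p, q) L.
     if L (l - 1) (p, q) \<noteq> {} \<and> real x \<le> bound p q (\<alpha> l)
     then insert_if_empty l (p + x, q + x * \<alpha> l) (p, q, x) L
     else L)"

definition step2 :: "(nat \<Rightarrow> nat) \<Rightarrow> nat \<Rightarrow> cell \<Rightarrow> tables \<Rightarrow> tables" where
  "step2 \<alpha> n = (\<lambda>(p, q) L.
     let b = bound p q (\<alpha> n); t = nat \<lfloor>b\<rfloor> in
     if L (n - 1) (p, q) \<noteq> {} \<and> b \<in> \<int> \<and> b \<ge> 1
     then insert_if_empty n (p + t, q + t * \<alpha> n) (p, q, t) L
     else L)"

text \<open>
  The ``for each'' loops do not fix an order of traversal, but the resulting tables depend on it.
  The order is therefore a parameter: \<open>xs l\<close> lists the values of \<open>x\<close> in round \<open>l\<close>, \<open>cs l x\<close> the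
  cells of table \<open>l - 1\<close> visited for this \<open>x\<close>, and \<open>ds\<close> the cells visited in the second part.
\<close>

definition valid_order ::
  "(nat \<Rightarrow> nat) \<Rightarrow> nat \<Rightarrow> (nat \<Rightarrow> nat list) \<Rightarrow> (nat \<Rightarrow> nat \<Rightarrow> cell list) \<Rightarrow> cell list \<Rightarrow> bool" where
  "valid_order \<alpha> n xs cs ds \<longleftrightarrow>
     (\<forall>l\<in>{1..n-1}. enumerates (xs l) {1..2 * \<alpha> l + 1} \<and>
        (\<forall>x\<in>{1..2 * \<alpha> l + 1}. enumerates (cs l x) (cells (\<alpha> (l - 1))))) \<and>
     enumerates ds (cells (\<alpha> (n - 1)))"

definition net_building ::
  "(nat \<Rightarrow> nat) \<Rightarrow> nat \<Rightarrow> (nat \<Rightarrow> nat list) \<Rightarrow> (nat \<Rightarrow> nat \<Rightarrow> cell list) \<Rightarrow> cell list \<Rightarrow> tables" where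
  "net_building \<alpha> n xs cs ds =
     fold (step2 \<alpha> n) ds
       (fold (\<lambda>l. fold (\<lambda>x. fold (step1 \<alpha> l x) (cs l x)) (xs l)) [1..<n] init_tables)"

text \<open>
  \<open>traceback L n c x\<close>: following stored triples from the cell \<open>c\<close> of table \<open>n\<close> down to table \<open>0\<close>
  can record the values \<open>x n, \<dots>, x 1\<close>; \<open>path l\<close> is the cell visited in table \<open>l\<close>.
\<close>

definition traceback :: "tables \<Rightarrow> nat \<Rightarrow> cell \<Rightarrow> (nat \<Rightarrow> nat) \<Rightarrow> bool" where
  "traceback L n c x \<longleftrightarrow>
     (\<exists>path. path n = c \<and>
        (\<forall>l\<in>{1..n}. (fst (path (l - 1)), snd (path (l - 1)), x l) \<in> L l (path l)))"

end

theory Submission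
  imports Defs
begin

text \<open>
  By Landau's theorem the multiplicities \<open>x\<close> are correct iff the partial sums
  \<open>p\<^sub>l = x\<^sub>1 + \<dots> + x\<^sub>l\<close> and \<open>q\<^sub>l = x\<^sub>1 \<alpha>\<^sub>1 + \<dots> + x\<^sub>l \<alpha>\<^sub>l\<close> satisfy
  \<open>p\<^sub>l choose 2 \<le> q\<^sub>l\<close>, with equality for \<open>l = n\<close>. The inequality propagates from
  \<open>l - 1\<close> to \<open>l\<close> exactly if \<open>x\<^sub>l\<close> does not exceed the larger root of a quadratic, which is
  \<open>bound\<close>. Hence the nonempty cells are the pairs \<open>(p\<^sub>l, q\<^sub>l)\<close> of admissible prefixes;
  since \<open>p\<^sub>l choose 2 \<le> q\<^sub>l \<le> p\<^sub>l \<alpha>\<^sub>l\<close>, they all lie in the index range of the tables.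
  Every stored triple inverts one such extension, whatever the order of traversal.
\<close>

section \<open>Landau's theorem\<close>

lemma Suc_choose_two: "Suc k choose 2 = k + (k choose 2)"
  by (simp add: numeral_2_eq_2)

lemma tournament_cases:
  assumes "tournament V R" "v \<in> V" "w \<in> V" "v \<noteq> w"
  shows "(v, w) \<in> R \<longleftrightarrow> (w, v) \<notin> R"
  using assms unfolding tournament_def total_on_def by (meson asymD)

lemma tournament_irrefl: "tournament V R \<Longrightarrow> (v, v) \<notin> R"
  unfolding tournament_def by (meson asymD)

lemma tournament_edge_in: "tournament V R \<Longrightarrow> (v, w) \<in> R \<Longrightarrow> v \<in> V \<and> w \<in> V"
  unfolding tournament_def by blast

lemma tournament_finite_out: "tournament V R \<Longrightarrow> finite {w. (v, w) \<in> R}"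
  by (rule finite_subset[of _ V]) (auto simp: tournament_def)

text \<open>Each unordered pair in \<open>S\<close> contributes exactly one edge. Adding a vertex
  \<open>a\<close> adds one edge per vertex of \<open>S\<close>, counted at \<open>a\<close> or at
  its opponent.\<close>

lemma tournament_sum_inner_degree:
  assumes "tournament V R" "S \<subseteq> V"
  shows "(\<Sum>v\<in>S. card {w\<in>S. (v, w) \<in> R}) = card S choose 2"
proof -
  have "finite S"
    using assms finite_subset unfolding tournament_def by blast
  then show ?thesis
    using assms(2)
  proof (induction S rule: finite_induct)
    case empty
    then show ?case by simp
  next
    case (insert a S)
    have split: "card {w\<in>insert a S. (v, w) \<in> R} = card {w\<in>S. (v, w) \<in> R} + (if (v, a) \<in> R then 1 else 0)"
      for v
    proof -
      have "{w\<in>insert a S. (v, w) \<in> R} =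
          (if (v, a) \<in> R then insert a {w\<in>S. (v, w) \<in> R} else {w\<in>S. (v, w) \<in> R})"
        by auto
      then show ?thesis
        using insert.hyps by simp
    qed
    \<comment> \<open>The vertices that \<open>a\<close> beats and those that beat \<open>a\<close>
      partition \<open>S\<close>.\<close>
    have "{w\<in>S. (a, w) \<in> R} = S - {w\<in>S. (w, a) \<in> R}"
      using tournament_cases[OF assms(1)] insert by blast
    then have cross: "card {w\<in>S. (a, w) \<in> R} + card {w\<in>S. (w, a) \<in> R} = card S"
      using insert.hyps card_mono[of S "{w\<in>S. (w, a) \<in> R}"] by (simp add: card_Diff_subset)
    have "(\<Sum>v\<in>S. if (v, a) \<in> R then 1 else 0) = card {w\<in>S. (w, a) \<in> R}"
      using insert.hyps by (simp add: sum.If_cases Int_def)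
    then have "(\<Sum>v\<in>insert a S. card {w\<in>insert a S. (v, w) \<in> R}) = (card S choose 2) + card S"
      unfolding split using insert cross tournament_irrefl[OF assms(1), of a] by (simp add: sum.distrib)
    then show ?case
      using insert.hyps by (simp add: Suc_choose_two)
  qed
qed

text \<open>The necessity half of Landau's theorem: edges leaving \<open>S\<close> can only enlarge
  the sum of the inner degrees.\<close>

lemma tournament_sum_out_degree_ge:
  assumes "tournament V R" "S \<subseteq> V"
  shows "card S choose 2 \<le> (\<Sum>v\<in>S. out_degree R v)"
proof -
  have "card {w\<in>S. (v, w) \<in> R} \<le> out_degree R v" for v
    unfolding out_degree_def by (intro card_mono tournament_finite_out[OF assms(1)]) auto
  then show ?thesis
    unfolding tournament_sum_inner_degree[OF assms, symmetric] by (intro sum_mono)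
qed

text \<open>With no edge leaving \<open>S\<close>, out-degrees and inner degrees agree. This is
  applied to sets of reachable vertices.\<close>

lemma tournament_sum_out_degree_closed:
  assumes "tournament V R" "S \<subseteq> V" "R `` S \<subseteq> S"
  shows "(\<Sum>v\<in>S. out_degree R v) = card S choose 2"
proof -
  have "{w\<in>S. (v, w) \<in> R} = {w. (v, w) \<in> R}" if "v \<in> S" for v
    using assms(3) that by blast
  then show ?thesis
    unfolding tournament_sum_inner_degree[OF assms(1,2), symmetric] out_degree_def by simp
qed

lemma tournament_sum_out_degree:
  "tournament V R \<Longrightarrow> (\<Sum>v\<in>V. out_degree R v) = card V choose 2"
  by (rule tournament_sum_out_degree_closed) (auto simp: tournament_def)

section \<open>Shifting one unit of score along an edge or a path\<close>

lemma reverse_edge: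
  assumes T: "tournament V R" and e: "(u, w) \<in> R"
  defines "R' \<equiv> insert (w, u) (R - {(u, w)})"
  shows "tournament V R'"
    and "out_degree R u = Suc (out_degree R' u)"
    and "out_degree R' w = Suc (out_degree R w)"
    and "\<And>v. v \<noteq> u \<Longrightarrow> v \<noteq> w \<Longrightarrow> out_degree R' v = out_degree R v"
proof -
  have ne: "u \<noteq> w" and wu: "(w, u) \<notin> R"
    using T e tournament_irrefl asymD unfolding tournament_def by metis+
  show "tournament V R'"
    using T e ne wu unfolding tournament_def R'_def total_on_def asym_on_def by auto
  have "{x. (u, x) \<in> R} = insert w {x. (u, x) \<in> R'}" "w \<notin> {x. (u, x) \<in> R'}"
    using e ne unfolding R'_def by auto
  then show "out_degree R u = Suc (out_degree R' u)"
    unfolding out_degree_def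
    using tournament_finite_out[OF \<open>tournament V R'\<close>, of u] by simp
  have "{x. (w, x) \<in> R'} = insert u {x. (w, x) \<in> R}" "u \<notin> {x. (w, x) \<in> R}"
    using wu ne unfolding R'_def by auto
  then show "out_degree R' w = Suc (out_degree R w)"
    unfolding out_degree_def using tournament_finite_out[OF T, of w] by simp
  show "out_degree R' v = out_degree R v" if "v \<noteq> u" "v \<noteq> w" for v
    unfolding out_degree_def using that by (simp add: R'_def)
qed

text \<open>Distinctness keeps the edges of the path independent when they are reversed one after
  another.\<close>

lemma rtrancl_distinct_path:
  assumes "(u, v) \<in> R\<^sup>*"
  obtains ps where "distinct (u # ps)" "successively (\<lambda>a b. (a, b) \<in> R) (u # ps)" "last (u # ps) = v"
proof -
  have "\<exists>ps. distinct (u # ps) \<and> successively (\<lambda>a b. (a, b) \<in> R) (u # ps) \<and> last (u # ps) = v"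
    using assms
  proof (induction rule: converse_rtrancl_induct)
    case base
    show ?case by (rule exI[of _ "[]"]) simp
  next
    case (step u w)
    then obtain ps where ps: "distinct (w # ps)" "successively (\<lambda>a b. (a, b) \<in> R) (w # ps)"
      "last (w # ps) = v" by blast
    show ?case
    proof (cases "u \<in> set (w # ps)")
      case True
      \<comment> \<open>A path that returns to \<open>u\<close> is cut down to its suffix starting
        there.\<close>
      then obtain ys zs where yz: "w # ps = ys @ u # zs"
        by (meson split_list)
      have "distinct (u # zs)" "successively (\<lambda>a b. (a, b) \<in> R) (u # zs)" "last (u # zs) = v"
        using ps unfolding yz by (auto simp: successively_append_iff)
      then show ?thesis by blast
    next
      case False
      then show ?thesis
        using ps step.hyps by (intro exI[of _ "w # ps"]) auto
    qed
  qed
  then show thesis using that by blast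
qed

text \<open>Inner vertices of the path gain one outgoing edge and lose another, so only the two end
  points change their scores.\<close>

lemma reverse_path:
  assumes "tournament V R" "distinct (u # ps)" "successively (\<lambda>a b. (a, b) \<in> R) (u # ps)" "ps \<noteq> []"
  shows "\<exists>R'. tournament V R' \<and> out_degree R u = Suc (out_degree R' u) \<and>
    out_degree R' (last ps) = Suc (out_degree R (last ps)) \<and>
    (\<forall>v. v \<noteq> u \<longrightarrow> v \<noteq> last ps \<longrightarrow> out_degree R' v = out_degree R v)"
  using assms
proof (induction ps arbitrary: R u)
  case Nil
  then show ?case by simp
next
  case (Cons w ps)
  define R1 where "R1 = insert (w, u) (R - {(u, w)})"
  have e: "(u, w) \<in> R"
    using Cons.prems by simp
  note R1 = reverse_edge[OF Cons.prems(1) e, folded R1_def]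
  show ?case
  proof (cases "ps = []")
    case True
    then show ?thesis using R1 by (intro exI[of _ R1]) auto
  next
    case False
    \<comment> \<open>The rest of the path survives in \<open>R1\<close>: only edges at
      \<open>u\<close> were changed, and \<open>u\<close> does not occur again.\<close>
    have "successively (\<lambda>a b. (a, b) \<in> R1) (w # ps)"
    proof (rule successively_mono)
      show "successively (\<lambda>a b. (a, b) \<in> R) (w # ps)"
        using Cons.prems by simp
      show "(a, b) \<in> R1" if "a \<in> set (w # ps)" "b \<in> set (w # ps)" "(a, b) \<in> R" for a b
        using that Cons.prems(2) unfolding R1_def by auto
    qed
    then obtain R' where R': "tournament V R'" "out_degree R1 w = Suc (out_degree R' w)"
      "out_degree R' (last ps) = Suc (out_degree R1 (last ps))"
      "\<And>v. v \<noteq> w \<Longrightarrow> v \<noteq> last ps \<Longrightarrow> out_degree R' v = out_degree R1 v"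
      using Cons.IH[OF R1(1)] Cons.prems(2) False by auto
    have ne: "last ps \<noteq> u" "last ps \<noteq> w" "u \<noteq> w"
      using Cons.prems(2) False last_in_set[of ps] by auto
    show ?thesis
    proof (intro exI[of _ R'] conjI allI impI)
      show "out_degree R' v = out_degree R v" if "v \<noteq> u" "v \<noteq> last (w # ps)" for v
        using R' R1 that False by (cases "v = w") auto
    qed (use R' R1 ne False in auto)
  qed
qed

text \<open>
  Take a tournament of least total excess. A path from a vertex of too large degree to one of too
  small degree could be reversed; so the set of vertices reachable from excessive ones contains
  no deficient vertex, and as no edge leaves it, its degree sum violates Landau's inequality.
\<close>

lemma landau_sufficient:
  fixes V :: "'a::linorder set"
  assumes fin: "finite V"
    and le: "\<And>S. S \<subseteq> V \<Longrightarrow> card S choose 2 \<le> sum s S"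
    and eq: "sum s V = card V choose 2"
  shows "\<exists>R. tournament V R \<and> (\<forall>v\<in>V. out_degree R v = s v)"
proof -
  \<comment> \<open>The transitive tournament given by the linear order shows that there is
    something to minimize over.\<close>
  have "tournament V {(a, b). a \<in> V \<and> b \<in> V \<and> a < b}"
    using fin unfolding tournament_def total_on_def asym_on_def by auto
  \<comment> \<open>Truncated subtraction makes this measure count excess only; deficits contribute
    0.\<close>
  from ex_has_least_nat[of "tournament V", OF this, of "\<lambda>R. \<Sum>v\<in>V. out_degree R v - s v"]
  obtain R where T: "tournament V R"
    and least: "\<And>R'. tournament V R' \<Longrightarrow>
      (\<Sum>v\<in>V. out_degree R v - s v) \<le> (\<Sum>v\<in>V. out_degree R' v - s v)"
    by blast
  have no_excess: "out_degree R u \<le> s u" if u: "u \<in> V" for u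
  proof (rule ccontr)
    assume ex: "\<not> out_degree R u \<le> s u"
    define S where "S = R\<^sup>* `` {u}"
    have "S \<subseteq> V"
    proof
      fix v assume "v \<in> S"
      then have "(u, v) \<in> R\<^sup>*" by (simp add: S_def)
      then show "v \<in> V"
        using u by (induction rule: rtrancl_induct) (auto dest: tournament_edge_in[OF T])
    qed
    have "R `` S \<subseteq> S"
      unfolding S_def by (auto intro: rtrancl_into_rtrancl)
    have S_excess: "s v \<le> out_degree R v" if "v \<in> S" for v
    proof (rule ccontr)
      assume def: "\<not> s v \<le> out_degree R v"
      from that have "(u, v) \<in> R\<^sup>*"
        by (simp add: S_def)
      then obtain ps where ps: "distinct (u # ps)" "successively (\<lambda>a b. (a, b) \<in> R) (u # ps)"
        "last (u # ps) = v"
        by (rule rtrancl_distinct_path)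
      have "ps \<noteq> []" using ps(3) ex def by auto
      with reverse_path[OF T ps(1,2)] ps(3) obtain R' where R': "tournament V R'"
        "out_degree R u = Suc (out_degree R' u)" "out_degree R' v = Suc (out_degree R v)"
        "\<And>w. w \<noteq> u \<Longrightarrow> w \<noteq> v \<Longrightarrow> out_degree R' w = out_degree R w"
        by auto
      have "(\<Sum>v\<in>V. out_degree R' v - s v) < (\<Sum>v\<in>V. out_degree R v - s v)"
      proof (rule sum_strict_mono_ex1[OF fin])
        show "\<forall>w\<in>V. out_degree R' w - s w \<le> out_degree R w - s w"
        proof
          fix w
          \<comment> \<open>At \<open>v\<close> the degree grows by one, but from below
            \<open>s v\<close>, so both truncated differences are 0 there.\<close>
          show "out_degree R' w - s w \<le> out_degree R w - s w"
            using R'(2,3) R'(4)[of w] def by (cases "w = u"; cases "w = v") simp_all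
        qed
        show "\<exists>w\<in>V. out_degree R' w - s w < out_degree R w - s w"
          using u R'(2) ex by (intro bexI[of _ u]) auto
      qed
      then show False using least[OF R'(1)] by simp
    qed
    have "sum s S < (\<Sum>v\<in>S. out_degree R v)"
    proof (rule sum_strict_mono_ex1)
      show "finite S" using \<open>S \<subseteq> V\<close> fin finite_subset by blast
      show "\<exists>v\<in>S. s v < out_degree R v"
        using ex by (intro bexI[of _ u]) (auto simp: S_def)
    qed (use S_excess in blast)
    also have "\<dots> = card S choose 2"
      by (rule tournament_sum_out_degree_closed) fact+
    also have "\<dots> \<le> sum s S"
      by (rule le) fact
    finally show False by simp
  qed
  have "(\<Sum>v\<in>V. out_degree R v) = sum s V"
    using eq tournament_sum_out_degree[OF T] by simp
  \<comment> \<open>Termwise inequality together with equal totals forces equality at every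
    vertex.\<close>
  from sum_mono_inv[OF this no_excess _ fin] have "\<forall>v\<in>V. out_degree R v = s v"
    by blast
  then show ?thesis using T by blast
qed

text \<open>A prefix of a sorted list has the least sum among selections of its size. Induction
  removes the largest index \<open>b\<close>, which is at least the number of remaining
  indices.\<close>

lemma sorted_sum_take_le:
  fixes s :: "nat list"
  assumes "sorted s" "S \<subseteq> {..<length s}"
  shows "sum_list (take (card S) s) \<le> (\<Sum>i\<in>S. s ! i)"
proof -
  have "finite S" using assms(2) finite_subset by blast
  then show ?thesis using assms(2)
  proof (induction S rule: finite_linorder_max_induct)
    case empty
    then show ?case by simp
  next
    case (insert b A)
    have "card A \<le> b"
      using card_mono[of "{..<b}" A] insert.hyps by auto
    moreover have "b < length s" using insert.prems by simp
    moreover have "b \<notin> A" using insert.hyps by blast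
    ultimately show ?case
      using insert sorted_nth_mono[OF assms(1), of "card A" b]
      by (simp add: take_Suc_conv_app_nth)
  qed
qed

text \<open>Sortedness reduces the condition on all vertex sets to prefixes. For sufficiency the
  positions of the list serve as vertices, so repeated scores cause no clash.\<close>

theorem landau:
  assumes "sorted s"
  shows "is_score_sequence s \<longleftrightarrow>
    (\<forall>k\<le>length s. k choose 2 \<le> sum_list (take k s)) \<and> sum_list s = length s choose 2"
proof
  assume "is_score_sequence s"
  then obtain V :: "nat set" and R vs where T: "tournament V R" and vs: "distinct vs" "set vs = V"
    and s: "s = map (out_degree R) vs"
    unfolding is_score_sequence_def enumerates_def by blast
  have sums: "sum_list (take k s) = (\<Sum>v\<in>set (take k vs). out_degree R v)" for k
    using vs(1) by (simp add: s take_map sum_list_distinct_conv_sum_set)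
  have "k choose 2 \<le> sum_list (take k s)" if "k \<le> length s" for k
  proof -
    have "card (set (take k vs)) = k"
      using that vs(1) s by (simp add: distinct_card)
    then show ?thesis
      using tournament_sum_out_degree_ge[OF T, of "set (take k vs)"] vs(2) sums[of k]
      by (metis set_take_subset)
  qed
  moreover have "sum_list s = length s choose 2"
    using tournament_sum_out_degree[OF T] vs
    by (simp add: s sum_list_distinct_conv_sum_set flip: distinct_card)
  ultimately show "(\<forall>k\<le>length s. k choose 2 \<le> sum_list (take k s)) \<and> sum_list s = length s choose 2"
    by blast
next
  assume *: "(\<forall>k\<le>length s. k choose 2 \<le> sum_list (take k s)) \<and> sum_list s = length s choose 2"
  have "\<exists>R. tournament {..<length s} R \<and> (\<forall>v\<in>{..<length s}. out_degree R v = s ! v)"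
  proof (rule landau_sufficient)
    fix S assume S: "S \<subseteq> {..<length s}"
    then have "card S \<le> length s"
      using card_mono[OF _ S] by simp
    then show "card S choose 2 \<le> sum ((!) s) S"
      using * sorted_sum_take_le[OF assms S] le_trans by blast
  qed (use * in \<open>auto simp: sum_list_sum_nth lessThan_atLeast0\<close>)
  then obtain R where "tournament {..<length s} R" "\<forall>v\<in>{..<length s}. out_degree R v = s ! v"
    by blast
  then show "is_score_sequence s"
    unfolding is_score_sequence_def enumerates_def
    by (intro exI[of _ "{..<length s}"] exI[of _ R] exI[of _ "[0..<length s]"])
      (auto intro: nth_equalityI simp: lessThan_atLeast0)
qed

section \<open>Score sequences with prescribed score set\<close>

definition score_list :: "(nat \<Rightarrow> nat) \<Rightarrow> (nat \<Rightarrow> nat) \<Rightarrow> nat \<Rightarrow> nat list" where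
  "score_list \<alpha> x l = concat (map (\<lambda>i. replicate (x i) (\<alpha> i)) [1..<l+1])"

lemma score_list_0 [simp]: "score_list \<alpha> x 0 = []"
  by (simp add: score_list_def)

lemma score_list_Suc [simp]:
  "score_list \<alpha> x (Suc l) = score_list \<alpha> x l @ replicate (x (Suc l)) (\<alpha> (Suc l))"
  by (simp add: score_list_def)

lemma length_score_list: "length (score_list \<alpha> x l) = (\<Sum>i=1..l. x i)"
  by (induction l) auto

lemma sum_list_score_list: "sum_list (score_list \<alpha> x l) = (\<Sum>i=1..l. x i * \<alpha> i)"
  by (induction l) (auto simp: sum_list_replicate)

lemma sorted_score_list:
  assumes "mono_on {1..l} \<alpha>"
  shows "sorted (score_list \<alpha> x l)"
proof -
  \<comment> \<open>The bound on the entries is carried along because appending a run keeps the list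
    sorted only if no earlier entry exceeds it.\<close>
  have "sorted (score_list \<alpha> x k) \<and> set (score_list \<alpha> x k) \<subseteq> \<alpha> ` {1..k}" if "k \<le> l" for k
    using that
  proof (induction k)
    case 0
    then show ?case by simp
  next
    case (Suc k)
    then show ?case
      using mono_onD[OF assms, of _ "Suc k"]
      by (fastforce simp: sorted_append split: if_splits)
  qed
  then show ?thesis by blast
qed

section \<open>Reducing Landau's inequalities to the ends of runs\<close>

lemma real_choose_two: "real (k choose 2) = real k * (real k - 1) / 2"
  by (induction k) (auto simp: Suc_choose_two field_simps)

text \<open>Within a run of equal scores the slack in Landau's inequality is concave.\<close>

lemma choose_two_between:
  assumes "p choose 2 \<le> q" "(p + x) choose 2 \<le> q + x * a" "j \<le> x"
  shows "(p + j) choose 2 \<le> q + j * a"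
proof (cases "x = 0")
  case True
  then show ?thesis using assms by simp
next
  case False
  define D where "D = real q - real p * (real p - 1) / 2"
  define h where "h = 2 * (real a - real p) + 1"
  have slack: "real (q + k * a) - real ((p + k) choose 2) = D + real k * (h - real k) / 2" for k
    by (simp add: real_choose_two D_def h_def field_simps)
  have D: "D \<ge> 0"
    using assms(1) slack[of 0] by simp
  have X: "D + real x * (h - real x) / 2 \<ge> 0"
    using assms(2) unfolding slack[symmetric] by (simp del: of_nat_add of_nat_mult)
  \<comment> \<open>With f(k) the slack after \<open>k\<close> copies, this reads x f(j) = j f(x) +
    (x - j) f(0) + j x (x - j) / 2, where every term on the right is nonnegative.\<close>
  have "real x * (D + real j * (h - real j) / 2) = real j * (D + real x * (h - real x) / 2)
      + (real x - real j) * D + real j * real x * (real x - real j) / 2"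
    by (simp add: field_simps)
  also have "\<dots> \<ge> 0"
    using mult_nonneg_nonneg[OF of_nat_0_le_iff[of j] X] D assms(3) by simp
  finally have "D + real j * (h - real j) / 2 \<ge> 0"
    using False by (simp add: zero_le_mult_iff)
  then show ?thesis
    unfolding slack[symmetric] by (simp del: of_nat_add of_nat_mult)
qed

text \<open>A position inside a run lies between two run ends, where
  \<open>choose_two_between\<close> applies.\<close>

lemma score_list_take_ge:
  assumes "\<And>k. k \<le> l \<Longrightarrow> (\<Sum>i=1..k. x i) choose 2 \<le> (\<Sum>i=1..k. x i * \<alpha> i)"
    and "j \<le> length (score_list \<alpha> x l)"
  shows "j choose 2 \<le> sum_list (take j (score_list \<alpha> x l))"
  using assms
proof (induction l)
  case 0
  then show ?case by simp
next
  case (Suc l)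
  show ?case
  proof (cases "j \<le> length (score_list \<alpha> x l)")
    case True
    then show ?thesis using Suc by simp
  next
    case False
    then obtain m where j: "j = length (score_list \<alpha> x l) + m"
      by (meson nat_le_linear nat_le_iff_add)
    with Suc.prems(2) have "m \<le> x (Suc l)" by simp
    moreover have "(\<Sum>i=1..l. x i) choose 2 \<le> (\<Sum>i=1..l. x i * \<alpha> i)"
      "((\<Sum>i=1..l. x i) + x (Suc l)) choose 2 \<le> (\<Sum>i=1..l. x i * \<alpha> i) + x (Suc l) * \<alpha> (Suc l)"
      using Suc.prems(1)[of l] Suc.prems(1)[of "Suc l"] by simp_all
    ultimately show ?thesis
      using choose_two_between[of "\<Sum>i=1..l. x i" "\<Sum>i=1..l. x i * \<alpha> i" "x (Suc l)" "\<alpha> (Suc l)" m]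
      by (simp add: j sum_list_replicate length_score_list sum_list_score_list min_def)
  qed
qed

lemma score_list_take_block:
  assumes "k \<le> l"
  shows "take (length (score_list \<alpha> x k)) (score_list \<alpha> x l) = score_list \<alpha> x k"
    and "length (score_list \<alpha> x k) \<le> length (score_list \<alpha> x l)"
  using assms by (induction l rule: dec_induct) auto

lemma correct_score_sequence_iff:
  assumes "mono_on {1..n} \<alpha>"
  shows "correct_score_sequence n \<alpha> x \<longleftrightarrow> (\<forall>i\<in>{1..n}. 1 \<le> x i) \<and>
    (\<forall>k\<le>n. (\<Sum>i=1..k. x i) choose 2 \<le> (\<Sum>i=1..k. x i * \<alpha> i)) \<and>
    (\<Sum>i=1..n. x i * \<alpha> i) = (\<Sum>i=1..n. x i) choose 2"
proof -
  \<comment> \<open>One direction interpolates inside the runs; the other holds because every run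
    end is itself a position of the list.\<close>
  have "(\<forall>j\<le>length (score_list \<alpha> x n). j choose 2 \<le> sum_list (take j (score_list \<alpha> x n))) \<longleftrightarrow>
    (\<forall>k\<le>n. (\<Sum>i=1..k. x i) choose 2 \<le> (\<Sum>i=1..k. x i * \<alpha> i))"
    using score_list_take_ge[of n x \<alpha>] score_list_take_block[of _ n \<alpha> x]
    by (metis length_score_list sum_list_score_list)
  then show ?thesis
    unfolding correct_score_sequence_def score_list_def[symmetric]
      landau[OF sorted_score_list[OF assms]]
    by (simp add: length_score_list sum_list_score_list)
qed

section \<open>The tables computed by the algorithm\<close>

text \<open>Twice the slack after adding \<open>x\<close> copies of \<open>a\<close> is a quadratic
  in \<open>x\<close> that factors over its two roots. The larger root is
  \<open>bound p q a\<close>; the smaller is at most 0, so for positive \<open>x\<close> the sign is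
  decided by the larger one.\<close>

lemma bound_iff:
  assumes "p choose 2 \<le> q" "1 \<le> x"
  shows "real x \<le> bound p q a \<longleftrightarrow> (p + x) choose 2 \<le> q + x * a" (is ?le)
    and "real x = bound p q a \<longleftrightarrow> (p + x) choose 2 = q + x * a" (is ?eq)
proof -
  define D where "D = real q - real p * (real p - 1) / 2"
  define h where "h = 2 * (real a - real p) + 1"
  define r where "r = sqrt (h\<^sup>2 + 8 * D)"
  have b: "bound p q a = (h + r) / 2"
    by (simp add: bound_def r_def h_def D_def Let_def)
  have slack: "real (q + x * a) - real ((p + x) choose 2) = D + real x * (h - real x) / 2"
    by (simp add: real_choose_two D_def h_def field_simps)
  have D: "D \<ge> 0"
    using assms(1) unfolding D_def real_choose_two[symmetric] by simp
  \<comment> \<open>Nonnegative slack \<open>D\<close> at \<open>(p, q)\<close> is what makes the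
    smaller root \<open>(h - r) / 2\<close> nonpositive.\<close>
  have "h \<le> r"
    unfolding r_def using D by (intro real_le_rsqrt) simp
  then have pos: "real x - (h - r) / 2 > 0"
    using assms(2) by simp
  have r2: "r * r = h * h + 8 * D"
    unfolding r_def using D by (simp add: power2_eq_square)
  have "(bound p q a - real x) * (real x - (h - r) / 2) =
      h * real x - real x * real x + (r * r - h * h) / 4"
    unfolding b by (simp add: field_simps)
  also have "\<dots> = 2 * (real (q + x * a) - real ((p + x) choose 2))"
    unfolding slack r2 by (simp add: field_simps)
  finally have prod: "(bound p q a - real x) * (real x - (h - r) / 2) =
    2 * (real (q + x * a) - real ((p + x) choose 2))" .
  have "real x \<le> bound p q a \<longleftrightarrow> 0 \<le> (bound p q a - real x) * (real x - (h - r) / 2)"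
    using pos by (simp add: zero_le_mult_iff)
  then show ?le unfolding prod by (simp del: of_nat_add of_nat_mult)
  have "real x = bound p q a \<longleftrightarrow> (bound p q a - real x) * (real x - (h - r) / 2) = 0"
    using pos by auto
  then show ?eq unfolding prod by (auto simp del: of_nat_add of_nat_mult)
qed

text \<open>Which triple ends up in a cell depends on the order of \<open>ts\<close>; which cells
  are filled, and that every new entry stems from a passed test, does not. The premise covers every
  \<open>L'\<close> agreeing with \<open>L\<close> outside table \<open>l\<close>, since the tests
  of a round read only the previous table.\<close>

lemma fold_insert_if_empty:
  assumes "\<And>t L'. t \<in> set ts \<Longrightarrow> (\<And>j. j \<noteq> l \<Longrightarrow> L' j = L j) \<Longrightarrow>
    step t L' = (if P t then insert_if_empty l (tgt t) (entry t) L' else L')"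
  shows "(\<forall>j. j \<noteq> l \<longrightarrow> fold step ts L j = L j) \<and>
    (\<forall>c. fold step ts L l c \<noteq> {} \<longleftrightarrow> L l c \<noteq> {} \<or> (\<exists>t\<in>set ts. P t \<and> tgt t = c)) \<and>
    (\<forall>c. \<forall>e\<in>fold step ts L l c. e \<in> L l c \<or> (\<exists>t\<in>set ts. P t \<and> tgt t = c \<and> entry t = e))"
  using assms
proof (induction ts arbitrary: L)
  case Nil
  then show ?case by simp
next
  case (Cons t ts)
  define L1 where "L1 = step t L"
  have L1: "L1 = (if P t then insert_if_empty l (tgt t) (entry t) L else L)"
    unfolding L1_def by (rule Cons.prems) auto
  have off: "L1 j = L j" if "j \<noteq> l" for j
    using that by (simp add: L1 insert_if_empty_def)
  have ne: "L1 l c \<noteq> {} \<longleftrightarrow> L l c \<noteq> {} \<or> (P t \<and> tgt t = c)" for c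
    by (auto simp: L1 insert_if_empty_def)
  have ent: "e \<in> L l c \<or> (P t \<and> tgt t = c \<and> entry t = e)" if "e \<in> L1 l c" for e c
    using that by (auto simp: L1 insert_if_empty_def split: if_splits)
  \<comment> \<open>The premise passes from \<open>L\<close> to \<open>L1\<close> because the two
    differ in table \<open>l\<close> only.\<close>
  have step: "step t' L' = (if P t' then insert_if_empty l (tgt t') (entry t') L' else L')"
    if "t' \<in> set ts" "\<And>j. j \<noteq> l \<Longrightarrow> L' j = L1 j" for t' L'
    using that off by (intro Cons.prems) auto
  have "(\<forall>j. j \<noteq> l \<longrightarrow> fold step ts L1 j = L1 j) \<and>
    (\<forall>c. fold step ts L1 l c \<noteq> {} \<longleftrightarrow> L1 l c \<noteq> {} \<or> (\<exists>t\<in>set ts. P t \<and> tgt t = c)) \<and>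
    (\<forall>c. \<forall>e\<in>fold step ts L1 l c. e \<in> L1 l c \<or> (\<exists>t\<in>set ts. P t \<and> tgt t = c \<and> entry t = e))"
    by (rule Cons.IH) (rule step)
  then have IH: "\<And>j. j \<noteq> l \<Longrightarrow> fold step ts L1 j = L1 j"
    "\<And>c. fold step ts L1 l c \<noteq> {} \<longleftrightarrow> L1 l c \<noteq> {} \<or> (\<exists>t\<in>set ts. P t \<and> tgt t = c)"
    "\<And>c e. e \<in> fold step ts L1 l c \<Longrightarrow> e \<in> L1 l c \<or> (\<exists>t\<in>set ts. P t \<and> tgt t = c \<and> entry t = e)"
    by blast+
  have fold_eq: "fold step (t # ts) L = fold step ts L1"
    by (simp add: L1_def)
  have 1: "\<forall>j. j \<noteq> l \<longrightarrow> fold step (t # ts) L j = L j"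
    unfolding fold_eq using IH(1) off by simp
  have 2: "\<forall>c. fold step (t # ts) L l c \<noteq> {} \<longleftrightarrow> L l c \<noteq> {} \<or> (\<exists>t\<in>set (t # ts). P t \<and> tgt t = c)"
    unfolding fold_eq IH(2) ne by auto
  have 3: "\<forall>c. \<forall>e\<in>fold step (t # ts) L l c. e \<in> L l c \<or>
      (\<exists>t\<in>set (t # ts). P t \<and> tgt t = c \<and> entry t = e)"
    unfolding fold_eq using IH(3) ent by fastforce
  from 1 2 3 show ?case by blast
qed

text \<open>Flattens the two nested loops of a round into one, to which
  \<open>fold_insert_if_empty\<close> applies.\<close>

lemma fold_fold_eq_fold_pairs:
  "fold (\<lambda>x. fold (f x) (g x)) ys = fold (\<lambda>(x, c). f x c) (concat (map (\<lambda>x. map (Pair x) (g x)) ys))"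
proof (induction ys)
  case Nil
  then show ?case by simp
next
  case (Cons y ys)
  then show ?case by (simp add: fold_map comp_def)
qed

text \<open>
  \<open>adm l p q x\<close> is the test which the algorithm applies before extending the cell \<open>(p, q)\<close> of
  table \<open>l - 1\<close> by \<open>x\<close>.
\<close>

definition table_filled ::
  "(nat \<Rightarrow> nat) \<Rightarrow> (nat \<Rightarrow> nat \<Rightarrow> nat \<Rightarrow> nat \<Rightarrow> bool) \<Rightarrow> tables \<Rightarrow> nat \<Rightarrow> bool" where
  "table_filled \<alpha> adm L l \<longleftrightarrow>
     (\<forall>c p q x. (p, q, x) \<in> L l c \<longrightarrow>
        1 \<le> x \<and> L (l - 1) (p, q) \<noteq> {} \<and> adm l p q x \<and> c = (p + x, q + x * \<alpha> l)) \<and>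
     (\<forall>p q x. (p, q) \<in> cells (\<alpha> (l - 1)) \<longrightarrow> L (l - 1) (p, q) \<noteq> {} \<longrightarrow>
        x \<in> {1..2 * \<alpha> l + 1} \<longrightarrow> adm l p q x \<longrightarrow> L l (p + x, q + x * \<alpha> l) \<noteq> {})"

lemma table_filled_cong:
  assumes "table_filled \<alpha> adm L l" "L' l = L l" "L' (l - 1) = L (l - 1)" "adm' l = adm l"
  shows "table_filled \<alpha> adm' L' l"
  using assms unfolding table_filled_def by simp

lemma first_part_round:
  assumes l: "1 \<le> l" and empty: "\<And>c. L l c = {}"
    and xs: "enumerates (xs l) {1..2 * \<alpha> l + 1}"
    and cs: "\<forall>x\<in>{1..2 * \<alpha> l + 1}. enumerates (cs l x) (cells (\<alpha> (l - 1)))"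
  defines "L' \<equiv> fold (\<lambda>x. fold (step1 \<alpha> l x) (cs l x)) (xs l) L"
  shows "table_filled \<alpha> (\<lambda>l p q x. real x \<le> bound p q (\<alpha> l)) L' l" and "\<And>j. j \<noteq> l \<Longrightarrow> L' j = L j"
proof -
  define ts where "ts = concat (map (\<lambda>x. map (Pair x) (cs l x)) (xs l))"
  define step where "step = (\<lambda>(x, c). step1 \<alpha> l x c)"
  define P where "P = (\<lambda>(x, (p, q)). L (l - 1) (p, q) \<noteq> {} \<and> real x \<le> bound p q (\<alpha> l))"
  define tgt where "tgt = (\<lambda>(x, (p, q)). (p + x, q + x * \<alpha> l))"
  define entry where "entry = (\<lambda>(x::nat, (p::nat, q::nat)). (p, q, x))"
  have L': "L' = fold step ts L"
    unfolding L'_def step_def ts_def by (rule fold_fold_eq_fold_pairs[THEN fun_cong])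
  have set_ts: "set ts = {1..2 * \<alpha> l + 1} \<times> cells (\<alpha> (l - 1))"
    using xs cs unfolding ts_def enumerates_def by auto
  have step_eq: "step t K = (if P t then insert_if_empty l (tgt t) (entry t) K else K)"
    if "\<And>j. j \<noteq> l \<Longrightarrow> K j = L j" for t K
    using that[of "l - 1"] l
    by (simp add: step_def P_def tgt_def entry_def step1_def split: prod.splits)
  have *: "(\<forall>j. j \<noteq> l \<longrightarrow> L' j = L j) \<and>
    (\<forall>c. L' l c \<noteq> {} \<longleftrightarrow> L l c \<noteq> {} \<or> (\<exists>t\<in>set ts. P t \<and> tgt t = c)) \<and>
    (\<forall>c. \<forall>e\<in>L' l c. e \<in> L l c \<or> (\<exists>t\<in>set ts. P t \<and> tgt t = c \<and> entry t = e))"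
    unfolding L' by (rule fold_insert_if_empty) (rule step_eq, blast)
  then show off: "\<And>j. j \<noteq> l \<Longrightarrow> L' j = L j" by blast
  have prev: "L' (l - 1) = L (l - 1)" using off l by simp
  show "table_filled \<alpha> (\<lambda>l p q x. real x \<le> bound p q (\<alpha> l)) L' l"
    unfolding table_filled_def prev
  proof (intro conjI allI impI)
    fix c p q x assume "(p, q, x) \<in> L' l c"
    then obtain t where "t \<in> set ts" "P t" "tgt t = c" "entry t = (p, q, x)"
      using * empty by blast
    \<comment> \<open>An entry records both the visited cell and \<open>x\<close>, hence determines
      the iteration that stored it.\<close>
    moreover then have "t = (x, (p, q))"
      by (auto simp: entry_def split: prod.splits)
    ultimately show "1 \<le> x" "L (l - 1) (p, q) \<noteq> {}" "real x \<le> bound p q (\<alpha> l)"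
      "c = (p + x, q + x * \<alpha> l)"
      by (auto simp: set_ts P_def tgt_def)
  next
    fix p q x assume "(p, q) \<in> cells (\<alpha> (l - 1))" "L (l - 1) (p, q) \<noteq> {}"
      "x \<in> {1..2 * \<alpha> l + 1}" "real x \<le> bound p q (\<alpha> l)"
    then have "(x, (p, q)) \<in> set ts" "P (x, (p, q))" "tgt (x, (p, q)) = (p + x, q + x * \<alpha> l)"
      by (auto simp: set_ts P_def tgt_def)
    then show "L' l (p + x, q + x * \<alpha> l) \<noteq> {}"
      using * by blast
  qed
qed

lemma second_part:
  assumes l: "1 \<le> l" and empty: "\<And>c. L l c = {}" and ds: "enumerates ds (cells (\<alpha> (l - 1)))"
  defines "L' \<equiv> fold (step2 \<alpha> l) ds L"
  shows "table_filled \<alpha> (\<lambda>l p q x. real x = bound p q (\<alpha> l)) L' l" and "\<And>j. j \<noteq> l \<Longrightarrow> L' j = L j"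
proof -
  define t where "t = (\<lambda>(p, q). nat \<lfloor>bound p q (\<alpha> l)\<rfloor>)"
  define P where "P = (\<lambda>(p, q). L (l - 1) (p, q) \<noteq> {} \<and> bound p q (\<alpha> l) \<in> \<int> \<and> bound p q (\<alpha> l) \<ge> 1)"
  define tgt where "tgt = (\<lambda>(p, q). (p + t (p, q), q + t (p, q) * \<alpha> l))"
  define entry where "entry = (\<lambda>(p, q). (p, q, t (p, q)))"
  have step_eq: "step2 \<alpha> l c K = (if P c then insert_if_empty l (tgt c) (entry c) K else K)"
    if "\<And>j. j \<noteq> l \<Longrightarrow> K j = L j" for c K
    using that[of "l - 1"] l
    by (simp add: P_def tgt_def entry_def step2_def t_def Let_def split: prod.splits)
  have *: "(\<forall>j. j \<noteq> l \<longrightarrow> L' j = L j) \<and>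
    (\<forall>c. L' l c \<noteq> {} \<longleftrightarrow> L l c \<noteq> {} \<or> (\<exists>d\<in>set ds. P d \<and> tgt d = c)) \<and>
    (\<forall>c. \<forall>e\<in>L' l c. e \<in> L l c \<or> (\<exists>d\<in>set ds. P d \<and> tgt d = c \<and> entry d = e))"
    unfolding L'_def by (rule fold_insert_if_empty) (rule step_eq, blast)
  then show off: "\<And>j. j \<noteq> l \<Longrightarrow> L' j = L j" by blast
  have prev: "L' (l - 1) = L (l - 1)" using off l by simp
  show "table_filled \<alpha> (\<lambda>l p q x. real x = bound p q (\<alpha> l)) L' l"
    unfolding table_filled_def prev
  proof (intro conjI allI impI)
    fix c p q x assume "(p, q, x) \<in> L' l c"
    then obtain d where d: "P d" "tgt d = c" "entry d = (p, q, x)"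
      using * empty by blast
    then have "d = (p, q)" and x: "x = nat \<lfloor>bound p q (\<alpha> l)\<rfloor>"
      by (auto simp: entry_def t_def split: prod.splits)
    with d have P: "L (l - 1) (p, q) \<noteq> {}" "bound p q (\<alpha> l) \<in> \<int>" "bound p q (\<alpha> l) \<ge> 1"
      and c: "c = (p + x, q + x * \<alpha> l)"
      by (auto simp: P_def tgt_def t_def)
    \<comment> \<open>Rounding down is exact because the bound is a positive integer.\<close>
    show "real x = bound p q (\<alpha> l)"
      using P(2,3) unfolding x by (auto elim!: Ints_cases)
    then show "1 \<le> x" using P(3) by simp
    show "L (l - 1) (p, q) \<noteq> {}" "c = (p + x, q + x * \<alpha> l)" by fact+
  next
    fix p q x assume "(p, q) \<in> cells (\<alpha> (l - 1))" "L (l - 1) (p, q) \<noteq> {}"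
      "x \<in> {1..2 * \<alpha> l + 1}" and b: "real x = bound p q (\<alpha> l)"
    then have "(p, q) \<in> set ds" "P (p, q)" "tgt (p, q) = (p + x, q + x * \<alpha> l)"
      using ds by (auto simp: P_def tgt_def t_def enumerates_def b[symmetric])
    then show "L' l (p + x, q + x * \<alpha> l) \<noteq> {}"
      using * by blast
  qed
qed

text \<open>Merges the tests of both parts of the algorithm, so that one induction over the tables
  covers them all.\<close>

definition admissible :: "(nat \<Rightarrow> nat) \<Rightarrow> nat \<Rightarrow> nat \<Rightarrow> nat \<Rightarrow> nat \<Rightarrow> nat \<Rightarrow> bool" where
  "admissible \<alpha> n l p q x \<longleftrightarrow>
     (if l < n then real x \<le> bound p q (\<alpha> l) else real x = bound p q (\<alpha> l))"

lemma net_building_tables: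
  assumes "1 \<le> n" "valid_order \<alpha> n xs cs ds"
  defines "L \<equiv> net_building \<alpha> n xs cs ds"
  shows "L 0 = init_tables 0" and "l \<in> {1..n} \<Longrightarrow> table_filled \<alpha> (admissible \<alpha> n) L l"
proof -
  \<comment> \<open>\<open>F m\<close> is the state before round \<open>m\<close>: tables from
    \<open>m\<close> on are still empty, and the earlier ones are final.\<close>
  define F where "F = (\<lambda>m. fold (\<lambda>l. fold (\<lambda>x. fold (step1 \<alpha> l x) (cs l x)) (xs l)) [1..<m] init_tables)"
  have F: "F m 0 = init_tables 0 \<and> (\<forall>j c. m \<le> j \<longrightarrow> F m j c = {}) \<and>
    (\<forall>l\<in>{1..<m}. table_filled \<alpha> (\<lambda>l p q x. real x \<le> bound p q (\<alpha> l)) (F m) l)"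
    if "1 \<le> m" "m \<le> n" for m
    using that
  proof (induction m rule: dec_induct)
    case base
    then show ?case by (simp add: F_def init_tables_def)
  next
    case (step m)
    have eq: "F (Suc m) = fold (\<lambda>x. fold (step1 \<alpha> m x) (cs m x)) (xs m) (F m)"
      using step.hyps by (simp add: F_def)
    have IH: "F m 0 = init_tables 0" "\<And>j c. m \<le> j \<Longrightarrow> F m j c = {}"
      "\<And>l. l \<in> {1..<m} \<Longrightarrow> table_filled \<alpha> (\<lambda>l p q x. real x \<le> bound p q (\<alpha> l)) (F m) l"
      using step by auto
    have "m \<in> {1..n-1}" using step by auto
    then have o: "enumerates (xs m) {1..2 * \<alpha> m + 1}"
        "\<forall>x\<in>{1..2 * \<alpha> m + 1}. enumerates (cs m x) (cells (\<alpha> (m - 1)))"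
      using assms(2) unfolding valid_order_def by blast+
    note r = first_part_round[of m "F m" xs \<alpha> cs, folded eq, OF step.hyps(1) IH(2)[OF order_refl] o]
    \<comment> \<open>Round \<open>m\<close> writes to table \<open>m\<close> only, so the
      description of earlier tables persists.\<close>
    have "table_filled \<alpha> (\<lambda>l p q x. real x \<le> bound p q (\<alpha> l)) (F (Suc m)) l" if "l \<in> {1..<m}" for l
      using that by (intro table_filled_cong[OF IH(3)[OF that]] r(2)) auto
    then show ?case
      using r IH step.hyps by (auto simp: less_Suc_eq)
  qed
  have L: "L = fold (step2 \<alpha> n) ds (F n)"
    by (simp add: L_def net_building_def F_def)
  have ds: "enumerates ds (cells (\<alpha> (n - 1)))"
    using assms(2) unfolding valid_order_def by blast
  have "F n n c = {}" for c
    using F[of n] assms(1) by blast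
  note s = second_part[of n "F n" ds \<alpha>, folded L, OF assms(1) this ds]
  show "L 0 = init_tables 0"
    using s(2)[of 0] F[of n] assms(1) by simp
  show "table_filled \<alpha> (admissible \<alpha> n) L l" if l: "l \<in> {1..n}"
  proof (cases "l = n")
    case True
    then show ?thesis
      by (intro table_filled_cong[OF s(1)[folded True]]) (auto simp: admissible_def fun_eq_iff)
  next
    case False
    with l have "l < n" and fl: "table_filled \<alpha> (\<lambda>l p q x. real x \<le> bound p q (\<alpha> l)) (F n) l"
      using F[of n] by auto
    then show ?thesis
      by (intro table_filled_cong[OF fl] s(2)) (auto simp: admissible_def fun_eq_iff)
  qed
qed

section \<open>Admissibility as Landau's inequality, and the index range of the tables\<close>

lemma admissible_iff:
  assumes "p choose 2 \<le> q" "1 \<le> x"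
  shows "admissible \<alpha> n l p q x \<longleftrightarrow>
    (if l < n then (p + x) choose 2 \<le> q + x * \<alpha> l else (p + x) choose 2 = q + x * \<alpha> l)"
  unfolding admissible_def using bound_iff[OF assms] by simp

text \<open>From p (p - 1) <= 2 q <= 2 p a it follows that p <= 2 a + 1. Hence the finite index
  range misses no prefix of a correct sequence.\<close>

lemma choose_two_le_imp_cells:
  assumes "p choose 2 \<le> q" "q \<le> p * a"
  shows "(p, q) \<in> cells a"
proof -
  have "p \<le> 2 * a + 1"
  proof (rule ccontr)
    assume "\<not> p \<le> 2 * a + 1"
    then have "p * (p - 1) > p * (2 * a)" by simp
    moreover have "p * (p - 1) \<le> 2 * (p * a)"
    proof -
      have "p * (p - 1) = 2 * (p choose 2)"
        by (cases p) (simp_all add: choose_two)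
      then show ?thesis
        using assms by simp
    qed
    ultimately show False by simp
  qed
  moreover from this have "q \<le> (2 * a + 1) * a"
    using assms(2) mult_le_mono1 le_trans by blast
  ultimately show ?thesis by (simp add: cells_def)
qed

theorem theorem3p6:
  fixes n :: nat and \<alpha> :: "nat \<Rightarrow> nat"
    and xs :: "nat \<Rightarrow> nat list" and cs :: "nat \<Rightarrow> nat \<Rightarrow> cell list" and ds :: "cell list"
    and L :: tables
  assumes "n \<ge> 2"
    and "strict_mono_on {1..n} \<alpha>"
    and "\<exists>x. correct_score_sequence n \<alpha> x"
    and "valid_order (\<alpha>(0 := 0)) n xs cs ds"
    and "L = net_building (\<alpha>(0 := 0)) n xs cs ds"
  shows "(\<exists>c\<in>cells (\<alpha> n). L n c \<noteq> {}) \<and>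
    (\<forall>c\<in>cells (\<alpha> n). L n c \<noteq> {} \<longrightarrow>
       (\<exists>x. traceback L n c x) \<and>
       (\<forall>x. traceback L n c x \<longrightarrow> correct_score_sequence n \<alpha> x))"
proof -
  \<comment> \<open>The algorithm sets the score at index 0 to 0, while the value of
    \<open>\<alpha>\<close> there is arbitrary.\<close>
  define \<beta> where "\<beta> = \<alpha>(0 := 0)"
  have \<beta>: "\<beta> i = \<alpha> i" if "1 \<le> i" for i
    using that by (simp add: \<beta>_def)
  have mono: "mono_on {1..n} \<alpha>"
    using assms(2) by (rule strict_mono_on_imp_mono_on)
  have L0: "L 0 = init_tables 0"
    and filled: "\<And>l. l \<in> {1..n} \<Longrightarrow> table_filled \<beta> (admissible \<beta> n) L l"
    using net_building_tables[of n \<beta> xs cs ds] assms(1,4,5) by (simp_all add: \<beta>_def)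
  have entryD: "1 \<le> x" "L (l - 1) (p, q) \<noteq> {}" "admissible \<beta> n l p q x" "c = (p + x, q + x * \<alpha> l)"
    if "l \<in> {1..n}" "(p, q, x) \<in> L l c" for l p q x c
  proof -
    have "1 \<le> x \<and> L (l - 1) (p, q) \<noteq> {} \<and> admissible \<beta> n l p q x \<and> c = (p + x, q + x * \<beta> l)"
      using filled[OF that(1)] that(2) unfolding table_filled_def by blast
    then show "1 \<le> x" "L (l - 1) (p, q) \<noteq> {}" "admissible \<beta> n l p q x" "c = (p + x, q + x * \<alpha> l)"
      using that(1) \<beta>[of l] by simp_all
  qed
  \<comment> \<open>Landau's inequality at the previous cell is what allows
    \<open>admissible_iff\<close> to carry it to the next one.\<close>
  have cell_ge: "p choose 2 \<le> q" if "l \<le> n" "L l (p, q) \<noteq> {}" for l p q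
    using that
  proof (induction l arbitrary: p q)
    case 0
    then show ?case by (simp add: L0 init_tables_def split: if_splits)
  next
    case (Suc l)
    then obtain p' q' x where e: "(p', q', x) \<in> L (Suc l) (p, q)" by auto
    have *: "Suc l \<in> {1..n}" using Suc.prems by simp
    have "p' choose 2 \<le> q'"
      using entryD(2)[OF * e] Suc by simp
    from admissible_iff[OF this entryD(1)[OF * e]] show ?case
      using entryD(3,4)[OF * e] \<beta>[of "Suc l"] by (auto split: if_splits)
  qed
  have ex_traceback: "\<exists>x. traceback L l c x" if "l \<le> n" "L l c \<noteq> {}" for l c
    using that
  proof (induction l arbitrary: c)
    case 0
    show ?case by (auto simp: traceback_def)
  next
    case (Suc l)
    then obtain p q x where e: "(p, q, x) \<in> L (Suc l) c" by auto
    have "L l (p, q) \<noteq> {}"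
      using entryD(2)[OF _ e] Suc.prems by simp
    then obtain y path where path: "path l = (p, q)"
      "\<forall>k\<in>{1..l}. (fst (path (k - 1)), snd (path (k - 1)), y k) \<in> L k (path k)"
      using Suc unfolding traceback_def by (metis Suc_leD)
    show ?case
      unfolding traceback_def
      using e path
      by (intro exI[of _ "y(Suc l := x)"] exI[of _ "path(Suc l := c)"]) (auto simp: le_Suc_eq)
  qed
  have traceback_correct: "correct_score_sequence n \<alpha> x" if tr: "traceback L n c x" for c x
  proof -
    from tr obtain path where
      path: "\<And>l. l \<in> {1..n} \<Longrightarrow> (fst (path (l - 1)), snd (path (l - 1)), x l) \<in> L l (path l)"
      unfolding traceback_def by blast
    \<comment> \<open>The first traced entry points to a nonempty cell of table 0, which can only be
      \<open>(0, 0)\<close>; from there the path accumulates the partial sums.\<close>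
    have sums: "path l = (\<Sum>i=1..l. x i, \<Sum>i=1..l. x i * \<alpha> i) \<and> L l (path l) \<noteq> {}" if "l \<le> n" for l
      using that
    proof (induction l)
      case 0
      have "L 0 (path 0) \<noteq> {}"
        using entryD(2)[OF _ path[of 1]] assms(1) by simp
      then show ?case
        by (simp add: L0 init_tables_def split: if_splits)
    next
      case (Suc l)
      have "(fst (path l), snd (path l), x (Suc l)) \<in> L (Suc l) (path (Suc l))"
        using path[of "Suc l"] Suc.prems by simp
      then show ?case
        using Suc entryD(4)[OF _ \<open>_ \<in> L (Suc l) _\<close>] by auto
    qed
    have x1: "1 \<le> x i" if "i \<in> {1..n}" for i
      using entryD(1)[OF that path[OF that]] .
    have le: "(\<Sum>i=1..k. x i) choose 2 \<le> (\<Sum>i=1..k. x i * \<alpha> i)" if "k \<le> n" for k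
      using cell_ge[OF that] sums[OF that] by metis
    obtain m where m: "n = Suc m" using assms(1) by (cases n) auto
    \<comment> \<open>The test on the last step is the equality, which yields the total required by
      Landau's theorem.\<close>
    have "admissible \<beta> n n (\<Sum>i=1..m. x i) (\<Sum>i=1..m. x i * \<alpha> i) (x n)"
      using entryD(3)[OF _ path[of n]] sums[of m] m by simp
    then have "(\<Sum>i=1..n. x i * \<alpha> i) = (\<Sum>i=1..n. x i) choose 2"
      using admissible_iff[OF le[of m] x1[of n], of \<beta> n n] \<beta>[of n] m by simp
    then show ?thesis
      unfolding correct_score_sequence_iff[OF mono] using x1 le by blast
  qed
  obtain x where x: "\<And>i. i \<in> {1..n} \<Longrightarrow> 1 \<le> x i"
    and le: "\<And>k. k \<le> n \<Longrightarrow> (\<Sum>i=1..k. x i) choose 2 \<le> (\<Sum>i=1..k. x i * \<alpha> i)"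
    and eq: "(\<Sum>i=1..n. x i * \<alpha> i) = (\<Sum>i=1..n. x i) choose 2"
    using assms(3) unfolding correct_score_sequence_iff[OF mono] by blast
  have in_cells: "(\<Sum>i=1..k. x i, \<Sum>i=1..k. x i * \<alpha> i) \<in> cells (\<beta> k)" if "k \<le> n" for k
  proof (rule choose_two_le_imp_cells[OF le[OF that]])
    have "x i * \<alpha> i \<le> x i * \<beta> k" if "i \<in> {1..k}" for i
      using that \<open>k \<le> n\<close> mono_onD[OF mono, of i k] \<beta>[of k] by simp
    then show "(\<Sum>i=1..k. x i * \<alpha> i) \<le> (\<Sum>i=1..k. x i) * \<beta> k"
      unfolding sum_distrib_right by (intro sum_mono)
  qed
  \<comment> \<open>Only nonemptiness is claimed: these cells may store triples that lead back to a
    different sequence.\<close>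
  have nonempty: "L k (\<Sum>i=1..k. x i, \<Sum>i=1..k. x i * \<alpha> i) \<noteq> {}" if "k \<le> n" for k
    using that
  proof (induction k)
    case 0
    then show ?case by (simp add: L0 init_tables_def)
  next
    case (Suc k)
    have *: "Suc k \<in> {1..n}" using Suc.prems by simp
    have "admissible \<beta> n (Suc k) (\<Sum>i=1..k. x i) (\<Sum>i=1..k. x i * \<alpha> i) (x (Suc k))"
      using admissible_iff[OF le[of k] x[OF *], of \<beta> n "Suc k"] \<beta>[of "Suc k"] le[of "Suc k"] eq Suc.prems
      by (cases "Suc k = n") auto
    \<comment> \<open>\<open>x (Suc k)\<close> is at most the partial sum up to
      \<open>Suc k\<close>, which the index range bounds.\<close>
    moreover have "x (Suc k) \<in> {1..2 * \<beta> (Suc k) + 1}"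
      using in_cells[of "Suc k"] x[OF *] Suc.prems by (auto simp: cells_def)
    ultimately have "L (Suc k) ((\<Sum>i=1..k. x i) + x (Suc k),
        (\<Sum>i=1..k. x i * \<alpha> i) + x (Suc k) * \<beta> (Suc k)) \<noteq> {}"
      using filled[OF *] in_cells[of k] Suc unfolding table_filled_def by simp
    then show ?case using \<beta>[of "Suc k"] by simp
  qed
  have "\<exists>c\<in>cells (\<alpha> n). L n c \<noteq> {}"
    using nonempty[of n] in_cells[of n] \<beta>[of n] assms(1) by auto
  then show ?thesis
    using ex_traceback traceback_correct by blast
qed

end
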